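(* For $H_1, H_2\in\mathcal{H}$, if $H_1\le H_2$ then $\dim H_1\le \dim H_2$.
   Context: All graphs are finite and simple, considered up to isomorphism. An edge-colored graph is a pair $(G,c)$ with $c\colon E(G)\to\mathbb{N}$ an arbitrary map (not necessarily proper); it is colored in $t$ or more colors if $|c(E(G))|\ge t$. A subgraph (not necessarily induced) is rainbow if its edges receive pairwise distinct colors. $(G,c)$ is rainbow $H$-free if $G$ contains no rainbow subgraph isomorphic to $H$. For graphs $H_1,H_2$, write $H_1\le H_2$ if there is a positive integer $t$ such that every rainbow $H_1$-free edge-colored complete graph colored in $t$ or more colors is rainbow $H_2$-free. $\mathcal{H}$ denotes the set of connected finite simple graphs other than the paths $P_1,P_2,P_3,P_4$ ($P_k$ is the path on $k$ vertices). For a connected graph $G$, $\dim G=|E(G)|-|V(G)|+1$. *)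

theory Defs imports Main
begin

record 'a sgraph =
  vertices :: "'a set"
  edges :: "'a set set"

definition simple_graph :: "'a sgraph \<Rightarrow> bool" where
  "simple_graph G \<longleftrightarrow>
     finite (vertices G) \<and> (\<forall>e\<in>edges G. e \<subseteq> vertices G \<and> card e = 2)"

definition adjacent :: "'a sgraph \<Rightarrow> 'a \<Rightarrow> 'a \<Rightarrow> bool" where
  "adjacent G u v \<longleftrightarrow> {u, v} \<in> edges G"

text \<open>The graph without vertices is not regarded as connected.\<close>
definition connected_graph :: "'a sgraph \<Rightarrow> bool" where
  "connected_graph G \<longleftrightarrow>
     vertices G \<noteq> {} \<and> (\<forall>u\<in>vertices G. \<forall>v\<in>vertices G. (adjacent G)\<^sup>*\<^sup>* u v)"

definition complete_graph :: "'a sgraph \<Rightarrow> bool" where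
  "complete_graph G \<longleftrightarrow>
     simple_graph G \<and> (\<forall>u\<in>vertices G. \<forall>v\<in>vertices G. u \<noteq> v \<longrightarrow> adjacent G u v)"

definition subgraph_of :: "'a sgraph \<Rightarrow> 'a sgraph \<Rightarrow> bool" where
  "subgraph_of F G \<longleftrightarrow>
     simple_graph F \<and> vertices F \<subseteq> vertices G \<and> edges F \<subseteq> edges G"

definition graph_iso :: "'a sgraph \<Rightarrow> 'b sgraph \<Rightarrow> bool" where
  "graph_iso G H \<longleftrightarrow>
     (\<exists>f. bij_betw f (vertices G) (vertices H) \<and>
          (\<forall>u\<in>vertices G. \<forall>v\<in>vertices G. adjacent G u v \<longleftrightarrow> adjacent H (f u) (f v)))"

text \<open>The path on \<open>k\<close> vertices (\<open>k - 1\<close> edges).\<close>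
definition path_graph :: "nat \<Rightarrow> nat sgraph" where
  "path_graph k = \<lparr>vertices = {..<k}, edges = {{i, Suc i} | i. Suc i < k}\<rparr>"

text \<open>An edge coloring is a total function on sets; only its values on the edges of the
  graph under consideration are ever used.\<close>
definition rainbow :: "'a sgraph \<Rightarrow> ('a set \<Rightarrow> nat) \<Rightarrow> bool" where
  "rainbow F c \<longleftrightarrow> inj_on c (edges F)"

definition colored_in_at_least :: "nat \<Rightarrow> 'a sgraph \<Rightarrow> ('a set \<Rightarrow> nat) \<Rightarrow> bool" where
  "colored_in_at_least t G c \<longleftrightarrow> t \<le> card (c ` edges G)"

definition rainbow_free :: "'b sgraph \<Rightarrow> 'a sgraph \<Rightarrow> ('a set \<Rightarrow> nat) \<Rightarrow> bool" where
  "rainbow_free H G c \<longleftrightarrow>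
     \<not> (\<exists>F. subgraph_of F G \<and> rainbow F c \<and> graph_iso F H)"

text \<open>Every finite graph is isomorphic to one whose vertices are natural numbers, so it is
  no restriction to let the complete graphs range over \<open>nat sgraph\<close>.\<close>
definition rainbow_le :: "'a sgraph \<Rightarrow> 'b sgraph \<Rightarrow> bool" where
  "rainbow_le H1 H2 \<longleftrightarrow>
     (\<exists>t>0. \<forall>(G :: nat sgraph) c.
        complete_graph G \<longrightarrow> colored_in_at_least t G c \<longrightarrow>
        rainbow_free H1 G c \<longrightarrow> rainbow_free H2 G c)"

definition connected_non_short_paths :: "'a sgraph set" where
  "connected_non_short_paths =
     {H. simple_graph H \<and> connected_graph H \<and>
         (\<forall>k\<in>{1, 2, 3, 4}. \<not> graph_iso H (path_graph k))}"

definition graph_dim :: "'a sgraph \<Rightarrow> int" where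
  "graph_dim G = int (card (edges G)) - int (card (vertices G)) + 1"

end

theory Submission imports Defs
begin

text \<open>
  Colour every edge of a complete graph on natural numbers by its larger end. A rainbow
  subgraph then has fewer edges than vertices, because distinct edges have distinct larger ends
  and the smallest vertex is not among them. Number the vertices of \<open>H2\<close> so that each vertex
  but the first has an earlier neighbour. One such edge per vertex gives a spanning tree, which is
  rainbow. Recolour the remaining \<open>graph_dim H2\<close> edges of \<open>H2\<close> with new distinct
  colours: now \<open>H2\<close> is rainbow, while every rainbow subgraph has dimension at most
  \<open>graph_dim H2\<close>. Further vertices supply as many colours as desired.
\<close>

section \<open>Invariance of edge number and dimension under isomorphism\<close>

lemma graph_iso_card_vertices:
  assumes "graph_iso G H"
  shows "card (vertices G) = card (vertices H)"
  using assms bij_betw_same_card unfolding graph_iso_def by blast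

lemma simple_graph_edgeE:
  assumes "simple_graph G" "e \<in> edges G"
  obtains u v where "e = {u, v}" "u \<noteq> v" "u \<in> vertices G" "v \<in> vertices G"
  using assms unfolding simple_graph_def by (metis card_2_iff insert_subset)

lemma simple_graph_finite_edges:
  assumes "simple_graph G"
  shows "finite (edges G)"
proof (rule finite_subset)
  show "edges G \<subseteq> Pow (vertices G)" "finite (Pow (vertices G))"
    using assms unfolding simple_graph_def by auto
qed

lemma graph_iso_card_edges:
  assumes "simple_graph G" "simple_graph H" "graph_iso G H"
  shows "card (edges G) = card (edges H)"
proof -
  obtain f where bij: "bij_betw f (vertices G) (vertices H)"
    and adj: "\<And>u v. u \<in> vertices G \<Longrightarrow> v \<in> vertices G \<Longrightarrow> adjacent G u v \<longleftrightarrow> adjacent H (f u) (f v)"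
    using assms(3) unfolding graph_iso_def by blast
  have "inj_on ((`) f) (edges G)"
  proof (rule inj_on_subset)
    show "inj_on ((`) f) (Pow (vertices G))"
      using bij by (simp add: bij_betw_def inj_on_image_Pow)
    show "edges G \<subseteq> Pow (vertices G)"
      using assms(1) unfolding simple_graph_def by auto
  qed
  moreover have "(`) f ` edges G = edges H"
  proof (intro equalityI subsetI)
    fix e assume "e \<in> (`) f ` edges G"
    then obtain d where d: "d \<in> edges G" "e = f ` d" by blast
    obtain u v where "d = {u, v}" "u \<in> vertices G" "v \<in> vertices G"
      using simple_graph_edgeE[OF assms(1) d(1)] by metis
    then show "e \<in> edges H" using adj[of u v] d by (simp add: adjacent_def)
  next
    fix e assume e: "e \<in> edges H"
    obtain x y where xy: "e = {x, y}" "x \<in> vertices H" "y \<in> vertices H"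
      using simple_graph_edgeE[OF assms(2) e] by metis
    obtain u v where uv: "u \<in> vertices G" "v \<in> vertices G" "f u = x" "f v = y"
      using bij xy(2,3) unfolding bij_betw_def by (metis imageE)
    then have "{u, v} \<in> edges G" using adj[of u v] xy e by (simp add: adjacent_def)
    then show "e \<in> (`) f ` edges G" using uv xy by (auto intro!: image_eqI[of _ _ "{u, v}"])
  qed
  ultimately show ?thesis by (metis card_image)
qed

lemma graph_iso_dim:
  assumes "simple_graph G" "simple_graph H" "graph_iso G H"
  shows "graph_dim G = graph_dim H"
  using graph_iso_card_vertices[OF assms(3)] graph_iso_card_edges[OF assms]
  by (simp add: graph_dim_def)

section \<open>Ordering the vertices of a connected graph\<close>

lemma connected_graph_edge_leaving:
  assumes "connected_graph G" "A \<noteq> {}" "A \<subset> vertices G"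
  obtains u v where "u \<in> A" "v \<notin> A" "adjacent G u v"
proof -
  obtain a b where ab: "a \<in> A" "b \<notin> A" "(adjacent G)\<^sup>*\<^sup>* a b"
    using assms unfolding connected_graph_def by blast
  \<comment> \<open>Look at the last step of the walk: either its start already lies outside
    \<open>A\<close> and induction applies, or this step itself leaves \<open>A\<close>.\<close>
  have "\<exists>u v. u \<in> A \<and> v \<notin> A \<and> adjacent G u v"
    using ab(3,1,2) by (induction rule: rtranclp_induct) auto
  then show ?thesis using that by blast
qed

text \<open>As long as some vertex is unlisted, connectivity gives an edge leaving the listed set;
  its outer end is listed next. Growing a prefix avoids deleting vertices from \<open>G\<close>,
  which could disconnect it.\<close>

lemma connected_enumeration_prefix:
  assumes "simple_graph G" "connected_graph G" "0 < k" "k \<le> card (vertices G)"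
  shows "\<exists>g. inj_on g {..<k} \<and> g ` {..<k} \<subseteq> vertices G \<and>
             (\<forall>j\<in>{0<..<k}. \<exists>i<j. adjacent G (g i) (g j))"
  using assms(3,4)
proof (induction k rule: nat_induct_non_zero)
  case 1
  obtain v where "v \<in> vertices G" using assms(2) unfolding connected_graph_def by blast
  then show ?case by (intro exI[of _ "\<lambda>_. v"]) (auto simp: inj_on_def)
next
  case (Suc k)
  then obtain g where g: "inj_on g {..<k}" "g ` {..<k} \<subseteq> vertices G"
    "\<And>j. 0 < j \<Longrightarrow> j < k \<Longrightarrow> \<exists>i<j. adjacent G (g i) (g j)"
    by fastforce
  have "card (g ` {..<k}) < card (vertices G)"
    using g(1) Suc.prems by (simp add: card_image)
  then have "g ` {..<k} \<subset> vertices G" using g(2) by auto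
  moreover have "g ` {..<k} \<noteq> {}" using Suc.hyps by auto
  ultimately obtain u v where uv: "u \<in> g ` {..<k}" "v \<notin> g ` {..<k}" "adjacent G u v"
    using connected_graph_edge_leaving[OF assms(2)] by metis
  have v: "v \<in> vertices G"
    using uv(3) assms(1) unfolding adjacent_def simple_graph_def by blast
  obtain i where i: "i < k" "u = g i" using uv(1) by auto
  show ?case
  proof (intro exI[of _ "g(k := v)"] conjI ballI)
    show "inj_on (g(k := v)) {..<Suc k}"
      using g(1) uv(2) by (auto simp: lessThan_Suc inj_on_def)
    show "(g(k := v)) ` {..<Suc k} \<subseteq> vertices G"
      using g(2) v by (auto simp: lessThan_Suc)
    fix j assume j: "j \<in> {0<..<Suc k}"
    show "\<exists>i<j. adjacent G ((g(k := v)) i) ((g(k := v)) j)"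
    proof (cases "j = k")
      case True
      then show ?thesis using i uv(3) by (intro exI[of _ i]) auto
    next
      case False
      then have "0 < j" "j < k" using j by auto
      with g(3) obtain l where "l < j" "adjacent G (g l) (g j)" by blast
      then show ?thesis using \<open>j < k\<close> by (intro exI[of _ l]) auto
    qed
  qed
qed

lemma connected_enumeration:
  assumes "simple_graph G" "connected_graph G"
  obtains g where "bij_betw g {..<card (vertices G)} (vertices G)"
    "\<And>j. 0 < j \<Longrightarrow> j < card (vertices G) \<Longrightarrow> \<exists>i<j. adjacent G (g i) (g j)"
proof -
  let ?n = "card (vertices G)"
  have fin: "finite (vertices G)" and "0 < ?n"
    using assms unfolding simple_graph_def connected_graph_def by (auto simp: card_gt_0_iff)
  then obtain g where g: "inj_on g {..<?n}" "g ` {..<?n} \<subseteq> vertices G"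
    "\<And>j. 0 < j \<Longrightarrow> j < ?n \<Longrightarrow> \<exists>i<j. adjacent G (g i) (g j)"
    using connected_enumeration_prefix[OF assms, of ?n] by fastforce
  have "g ` {..<?n} = vertices G"
    using g(1,2) fin by (intro card_subset_eq) (simp_all add: card_image)
  with g that show ?thesis unfolding bij_betw_def by blast
qed

text \<open>Renaming each vertex to its position in the enumeration turns "earlier" into "smaller",
  so that \<open>Max\<close> picks the later end of an edge.\<close>

lemma connected_graph_nat_copy:
  fixes G :: "'a sgraph"
  assumes "simple_graph G" "connected_graph G"
  obtains F :: "nat sgraph" where "simple_graph F" "graph_iso F G"
    "vertices F = {..<card (vertices G)}"
    "\<And>j. 0 < j \<Longrightarrow> j < card (vertices G) \<Longrightarrow> \<exists>i<j. adjacent F i j"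
proof -
  let ?n = "card (vertices G)"
  obtain g where g: "bij_betw g {..<?n} (vertices G)"
    "\<And>j. 0 < j \<Longrightarrow> j < ?n \<Longrightarrow> \<exists>i<j. adjacent G (g i) (g j)"
    using connected_enumeration[OF assms] by metis
  define F where "F = \<lparr>vertices = {..<?n},
    edges = {{i, j} | i j. i < ?n \<and> j < ?n \<and> adjacent G (g i) (g j)}\<rparr>"
  \<comment> \<open>The set \<open>{i, j}\<close> may also arise from the pair in reverse order,
    hence the appeal to symmetry of adjacency.\<close>
  have adj: "adjacent F i j \<longleftrightarrow> adjacent G (g i) (g j)" if "i < ?n" "j < ?n" for i j
    using that by (auto simp: F_def adjacent_def doubleton_eq_iff insert_commute[of "g i"])
  have irrefl: "\<not> adjacent G v v" for v
    using assms(1) unfolding simple_graph_def adjacent_def by force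
  have "card {i, j} = 2" if "adjacent G (g i) (g j)" for i j
    using that irrefl by (cases "i = j") auto
  then have "simple_graph F"
    unfolding simple_graph_def F_def by auto
  moreover have "graph_iso F G"
    unfolding graph_iso_def using g(1) adj by (intro exI[of _ g]) (auto simp: F_def)
  moreover have "\<exists>i<j. adjacent F i j" if "0 < j" "j < ?n" for j
    using g(2)[OF that] adj that by (meson order.strict_trans)
  ultimately show ?thesis using that by (simp add: F_def)
qed

section \<open>Colouring edges by their larger end\<close>

lemma card_edges_inj_Max:
  fixes F :: "nat sgraph"
  assumes "simple_graph F" "vertices F \<noteq> {}" "A \<subseteq> edges F" "inj_on Max A"
  shows "card A < card (vertices F)"
proof -
  have fin: "finite (vertices F)" using assms(1) by (simp add: simple_graph_def)
  \<comment> \<open>The larger end of an edge exceeds the other end, so it is never the least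
    vertex.\<close>
  have "Max ` A \<subseteq> vertices F - {Min (vertices F)}"
  proof
    fix m assume "m \<in> Max ` A"
    then obtain e where e: "e \<in> A" "m = Max e" by blast
    then obtain u v where uv: "e = {u, v}" "u \<noteq> v" "u \<in> vertices F" "v \<in> vertices F"
      using simple_graph_edgeE[OF assms(1)] assms(3) by blast
    have "Min (vertices F) \<le> u" "Min (vertices F) \<le> v" using uv fin by auto
    then show "m \<in> vertices F - {Min (vertices F)}"
      using uv e by (auto simp: max_def)
  qed
  then have "card (Max ` A) \<le> card (vertices F - {Min (vertices F)})"
    using fin by (intro card_mono) auto
  also have "\<dots> < card (vertices F)"
    using fin assms(2) by (intro card_Diff1_less) auto
  finally show ?thesis using assms(4) by (simp add: card_image)
qed

text \<open>Joining each \<open>j\<close> to a chosen smaller neighbour \<open>p j\<close> gives an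
  edge from which \<open>Max\<close> recovers \<open>j\<close>. Hence these edges are distinct and
  have distinct larger ends.\<close>

lemma spanning_tree_inj_Max:
  fixes F :: "nat sgraph"
  assumes "\<And>j. 0 < j \<Longrightarrow> j < n \<Longrightarrow> \<exists>i<j. adjacent F i j"
  obtains T where "T \<subseteq> edges F" "card T = n - 1" "inj_on Max T" "Max ` T \<subseteq> {..<n}"
proof -
  obtain p where p: "\<And>j. 0 < j \<Longrightarrow> j < n \<Longrightarrow> p j < j \<and> adjacent F (p j) j"
    using assms by metis
  let ?h = "\<lambda>j. {p j, j}"
  have M: "Max (?h j) = j" if "j \<in> {0<..<n}" for j using p[of j] that by auto
  show ?thesis
  proof
    show "?h ` {0<..<n} \<subseteq> edges F" using p by (auto simp: adjacent_def)
    have "inj_on ?h {0<..<n}" by (rule inj_on_inverseI[of _ Max]) (rule M)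
    then show "card (?h ` {0<..<n}) = n - 1" by (simp add: card_image)
    show "inj_on Max (?h ` {0<..<n})" using M by (intro inj_onI) force
    show "Max ` ?h ` {0<..<n} \<subseteq> {..<n}" using M by force
  qed
qed

text \<open>With \<open>F\<close> a copy of \<open>H2\<close> and \<open>t\<close> arbitrary, this
  colouring refutes \<open>rainbow_le H1 H2\<close> whenever \<open>H1\<close> has the larger
  dimension.\<close>

lemma rainbow_coloring_bounded_dim:
  fixes F :: "nat sgraph"
  assumes F: "simple_graph F" "vertices F = {..<n}" "0 < n"
    and earlier: "\<And>j. 0 < j \<Longrightarrow> j < n \<Longrightarrow> \<exists>i<j. adjacent F i j"
  obtains G :: "nat sgraph" and c where "complete_graph G" "colored_in_at_least t G c"
    "subgraph_of F G" "rainbow F c"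
    "\<And>K. subgraph_of K G \<Longrightarrow> rainbow K c \<Longrightarrow> vertices K \<noteq> {} \<Longrightarrow> graph_dim K \<le> graph_dim F"
proof -
  obtain T where T: "T \<subseteq> edges F" "card T = n - 1" "inj_on Max T" "Max ` T \<subseteq> {..<n}"
    using spanning_tree_inj_Max[OF earlier] by blast
  define X where "X = edges F - T"
  have finF: "finite (edges F)" using F(1) by (rule simple_graph_finite_edges)
  then have finX: "finite X" by (simp add: X_def)
  \<comment> \<open>Removing \<open>n - 1\<close> edges from a graph on \<open>n\<close> vertices
    leaves as many edges as its dimension; \<open>0 < n\<close> makes the natural subtraction
    exact.\<close>
  have cardX: "int (card X) = graph_dim F"
    using T(1,2) F(2,3) finF card_mono[OF finF T(1)]
    by (simp add: X_def graph_dim_def card_Diff_subset finite_subset)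
  obtain h :: "nat set \<Rightarrow> nat" where h: "inj_on h X"
    using finite_imp_inj_to_nat_seg[OF finX] by blast
  \<comment> \<open>The \<open>t\<close> vertices from \<open>n\<close> on lie outside
    \<open>F\<close> and supply \<open>t\<close> colours.\<close>
  define N where "N = n + t"
  define G where "G = \<lparr>vertices = {..<N}, edges = {{i, j} | i j. i < N \<and> j < N \<and> i \<noteq> j}\<rparr>"
  have edge_G: "{i, j} \<in> edges G" if "i < N" "j < N" "i \<noteq> j" for i j
    using that unfolding G_def by simp blast
  \<comment> \<open>Larger ends are below \<open>N\<close>, so the shift by \<open>N\<close> keeps
    the new colours apart from them.\<close>
  define c where "c e = (if e \<in> X then N + h e else Max e)" for e
  have "complete_graph G"
    by (auto simp: complete_graph_def simple_graph_def adjacent_def G_def)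
  moreover have "colored_in_at_least t G c"
  proof -
    have "{n..<N} \<subseteq> c ` edges G"
    proof
      fix j assume j: "j \<in> {n..<N}"
      \<comment> \<open>All edges in \<open>X\<close> lie within \<open>{..<n}\<close>, so this edge
        keeps its larger end \<open>j\<close> as colour.\<close>
      have "{0, j} \<notin> X"
        using j F(1,2) unfolding X_def simple_graph_def by auto
      then have "c {0, j} = j" by (simp add: c_def)
      moreover have "{0, j} \<in> edges G" using j F(3) by (intro edge_G) auto
      ultimately show "j \<in> c ` edges G" by (metis image_eqI)
    qed
    moreover have "finite (edges G)"
      using \<open>complete_graph G\<close> by (simp add: complete_graph_def simple_graph_finite_edges)
    ultimately have "card {n..<N} \<le> card (c ` edges G)" by (intro card_mono) auto
    then show ?thesis by (simp add: colored_in_at_least_def N_def)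
  qed
  moreover have "subgraph_of F G"
  proof -
    have "e \<in> edges G" if e: "e \<in> edges F" for e
    proof -
      obtain i j where "e = {i, j}" "i \<noteq> j" "i < n" "j < n"
        using simple_graph_edgeE[OF F(1) e] F(2) by auto
      then show ?thesis by (simp add: edge_G N_def)
    qed
    then show ?thesis using F by (auto simp: subgraph_of_def G_def N_def)
  qed
  moreover have "rainbow F c"
  proof -
    have F_eq: "edges F = X \<union> T" using T(1) by (auto simp: X_def)
    have cT: "c e = Max e" "c e < N" if "e \<in> T" for e
      using that T(4) by (force simp: c_def X_def N_def)+
    have cX: "c e = N + h e" if "e \<in> X" for e using that by (simp add: c_def)
    have "inj_on c X" using h cX by (simp add: inj_on_def)
    moreover have "inj_on c T" using T(3) cT(1) by (simp add: inj_on_def)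
    moreover have "c ` X \<inter> c ` T = {}" using cT(2) cX by fastforce
    ultimately show ?thesis unfolding rainbow_def F_eq inj_on_Un by blast
  qed
  moreover have "graph_dim K \<le> graph_dim F"
    if K: "subgraph_of K G" "rainbow K c" "vertices K \<noteq> {}" for K
  proof -
    have simpK: "simple_graph K" using K(1) by (simp add: subgraph_of_def)
    \<comment> \<open>Off \<open>X\<close> the colour is \<open>Max\<close>, so a rainbow
      \<open>K\<close> has fewer such edges than vertices. The strict inequality absorbs the
      \<open>+ 1\<close> in \<open>graph_dim\<close>.\<close>
    have "inj_on c (edges K - X)" using K(2) unfolding rainbow_def by (rule inj_on_diff)
    then have "inj_on Max (edges K - X)" by (simp add: inj_on_def c_def)
    then have "card (edges K - X) < card (vertices K)"
      using card_edges_inj_Max[OF simpK K(3)] by blast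
    moreover have "card (edges K) \<le> card X + card (edges K - X)"
    proof -
      have "card (edges K) \<le> card (X \<union> (edges K - X))"
        using finX simple_graph_finite_edges[OF simpK] by (intro card_mono) auto
      also have "\<dots> \<le> card X + card (edges K - X)" by (rule card_Un_le)
      finally show ?thesis .
    qed
    ultimately have "graph_dim K \<le> int (card X)" unfolding graph_dim_def by linarith
    then show ?thesis by (simp only: cardX)
  qed
  ultimately show ?thesis using that by blast
qed

theorem theorem4:
  fixes H1 :: "'a sgraph" and H2 :: "'b sgraph"
  assumes "H1 \<in> connected_non_short_paths"
    and "H2 \<in> connected_non_short_paths"
    and "rainbow_le H1 H2"
  shows "graph_dim H1 \<le> graph_dim H2"
proof -
  have H1: "simple_graph H1" "vertices H1 \<noteq> {}" and H2: "simple_graph H2" "connected_graph H2"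
    using assms(1,2) by (auto simp: connected_non_short_paths_def connected_graph_def)
  have n: "0 < card (vertices H2)"
    using H2 by (auto simp: simple_graph_def connected_graph_def card_gt_0_iff)
  obtain F :: "nat sgraph" where F: "simple_graph F" "graph_iso F H2"
    "vertices F = {..<card (vertices H2)}"
    "\<And>j. 0 < j \<Longrightarrow> j < card (vertices H2) \<Longrightarrow> \<exists>i<j. adjacent F i j"
    using connected_graph_nat_copy[OF H2] by blast
  obtain t where t: "\<And>(G :: nat sgraph) c. complete_graph G \<Longrightarrow> colored_in_at_least t G c \<Longrightarrow>
      rainbow_free H1 G c \<Longrightarrow> rainbow_free H2 G c"
    using assms(3) unfolding rainbow_le_def by blast
  obtain G :: "nat sgraph" and c where G: "complete_graph G" "colored_in_at_least t G c"
    "subgraph_of F G" "rainbow F c"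
    and dim: "\<And>K. subgraph_of K G \<Longrightarrow> rainbow K c \<Longrightarrow> vertices K \<noteq> {} \<Longrightarrow> graph_dim K \<le> graph_dim F"
    using rainbow_coloring_bounded_dim[OF F(1,3) n F(4)] by blast
  have "\<not> rainbow_free H2 G c"
    using G(3,4) F(2) unfolding rainbow_free_def by blast
  \<comment> \<open>The contrapositive of \<open>t\<close> turns the rainbow copy \<open>F\<close>
    of \<open>H2\<close> into a rainbow copy of \<open>H1\<close>.\<close>
  then have "\<not> rainbow_free H1 G c" using t[OF G(1,2)] by blast
  then obtain K where K: "subgraph_of K G" "rainbow K c" "graph_iso K H1"
    unfolding rainbow_free_def by blast
  have simpK: "simple_graph K" using K(1) by (simp add: subgraph_of_def)
  \<comment> \<open>The empty graph has \<open>graph_dim\<close> 1, which would break the bound when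
    \<open>F\<close> is a tree.\<close>
  have "vertices K \<noteq> {}" using K(3) H1(2) by (auto simp: graph_iso_def bij_betw_def)
  then have "graph_dim K \<le> graph_dim F" using dim K by blast
  then show ?thesis
    using graph_iso_dim[OF simpK H1(1) K(3)] graph_iso_dim[OF F(1) H2(1) F(2)] by simp
qed

end
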